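(* Let $n\ge2$, let $x_1,\dots,x_{n-1}$ be positive real numbers, and let $p(x)=x\prod_{i=1}^{n-1}(x-x_i)$, so that the smallest root of $p$ is $0$. Let $H_{n-1}$ be the harmonic mean of $x_1,\dots,x_{n-1}$. Then the smallest root $\mu_*$ of the derivative $p'(x)$ satisfies $$\tfrac12 H_{n-1}\le (n-1)\mu_*\le H_{n-1}.$$
   Context: The harmonic mean is defined by $\frac{1}{H_{n-1}}=\frac{1}{n-1}\sum_{i=1}^{n-1}\frac1{x_i}$. All roots of $p$ are real, hence so are those of $p'$. *)

theory Defs
  imports "HOL-Computational_Algebra.Polynomial"
begin

text \<open>
  Roots are real roots. There is at most one \<open>\<mu>\<close> with \<^term>\<open>is_smallest_root q \<mu>\<close>,
  and there is none if \<open>q\<close> has no real root or if \<open>q = 0\<close>.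
\<close>

definition is_smallest_root :: "real poly \<Rightarrow> real \<Rightarrow> bool" where
  "is_smallest_root q \<mu> \<longleftrightarrow> poly q \<mu> = 0 \<and> (\<forall>r. poly q r = 0 \<longrightarrow> \<mu> \<le> r)"

lemma is_smallest_root_unique:
  "is_smallest_root q \<mu> \<Longrightarrow> is_smallest_root q \<nu> \<Longrightarrow> \<mu> = \<nu>"
  unfolding is_smallest_root_def by (meson order_antisym)

text \<open>The harmonic mean of \<open>x\<^sub>1, \<dots>, x\<^sub>m\<close>; the other values of \<open>x\<close> are irrelevant.\<close>

definition harmonic_mean :: "nat \<Rightarrow> (nat \<Rightarrow> real) \<Rightarrow> real" where
  "harmonic_mean m x = 1 / ((1 / real m) * (\<Sum>i=1..m. 1 / x i))"

end

theory Submission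
  imports Defs
begin

text \<open>
  Put \<open>S = \<Sum> 1/x\<^sub>i\<close>, so that the claim reads \<open>1/(2S) \<le> \<mu> \<le> 1/S\<close>. Up to sign, \<open>p'(t)\<close> is
  \<open>F(t) = \<Prod>(x\<^sub>i - t) - t \<Sum>\<^sub>i \<Prod>\<^sub>j\<^sub>\<noteq>\<^sub>i (x\<^sub>j - t)\<close>. For \<open>t < 1/(2S)\<close> every \<open>x\<^sub>i - t\<close> exceeds
  \<open>x\<^sub>i/2\<close>, which makes \<open>F(t)\<close> positive. At \<open>t = 1/S\<close> all factors are nonnegative and
  \<open>F(t) = t \<Sum>\<^sub>i ((x\<^sub>i - t)/x\<^sub>i - 1) \<Prod>\<^sub>j\<^sub>\<noteq>\<^sub>i (x\<^sub>j - t) \<le> 0\<close>, so \<open>F\<close> has a root in \<open>[0, 1/S]\<close>.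
\<close>

text \<open>The factors are oriented as \<open>x i - t\<close> because that sign makes them
  nonnegative wherever the two estimates below need a nonnegative product.\<close>

lemma poly_pderiv_prod_linear:
  fixes x :: "'a \<Rightarrow> real"
  shows "poly (pderiv ([:0, 1:] * (\<Prod>i\<in>A. [:x i, - 1:]))) t =
    (\<Prod>i\<in>A. x i - t) - t * (\<Sum>i\<in>A. \<Prod>j\<in>A - {i}. x j - t)"
  by (simp add: pderiv_mult pderiv_prod poly_sum poly_prod pderiv_pCons sum_negf sum_distrib_left)

context
  fixes A :: "'a set" and x :: "'a \<Rightarrow> real"
  assumes fin: "finite A" and pos: "\<And>i. i \<in> A \<Longrightarrow> x i > 0"
begin

text \<open>This places each \<open>x i\<close> at or above the reciprocal of the whole sum, which
  controls the sign of \<open>x i - t\<close> up to that reciprocal.\<close>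

lemma inverse_le_sum_inverse: "i \<in> A \<Longrightarrow> 1 / x i \<le> (\<Sum>i\<in>A. 1 / x i)"
  by (rule member_le_sum) (use fin pos in \<open>auto simp: less_imp_le\<close>)

text \<open>For \<open>r > 0\<close>, omitting the factor \<open>x i - r > x i / 2\<close> from the
  full product \<open>?Q\<close> leaves at most \<open>2 * ?Q / x i\<close>. Summing over
  \<open>i\<close>, the subtracted term is at most \<open>?Q\<close> times the quantity assumed to
  be below 1. For \<open>r \<le> 0\<close> the subtracted term is nonpositive.\<close>

lemma pderiv_pos_below:
  assumes r: "2 * r * (\<Sum>i\<in>A. 1 / x i) < 1"
  shows "(\<Prod>i\<in>A. x i - r) - r * (\<Sum>i\<in>A. \<Prod>j\<in>A - {i}. x j - r) > 0"
proof -
  let ?Q = "\<Prod>i\<in>A. x i - r"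
  have half: "x i / 2 < x i - r" if i: "i \<in> A" for i
  proof (cases "r \<le> 0")
    case True
    then show ?thesis using pos[OF i] by simp
  next
    case False
    then have "2 * r * (1 / x i) \<le> 2 * r * (\<Sum>i\<in>A. 1 / x i)"
      by (intro mult_left_mono inverse_le_sum_inverse i) auto
    then have "2 * r / x i < 1" using r by simp
    then show ?thesis using pos[OF i] by (simp add: field_simps)
  qed
  have gt: "x i - r > 0" if "i \<in> A" for i
    using half[OF that] pos[OF that] by linarith
  have Q: "?Q > 0" using gt by (intro prod_pos) auto
  show ?thesis
  proof (cases "r \<le> 0")
    case True
    have "(\<Sum>i\<in>A. \<Prod>j\<in>A - {i}. x j - r) \<ge> 0"
      using gt by (intro sum_nonneg prod_nonneg) (auto simp: less_imp_le)
    then have "r * (\<Sum>i\<in>A. \<Prod>j\<in>A - {i}. x j - r) \<le> 0"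
      using True by (rule mult_nonpos_nonneg[rotated])
    then show ?thesis using Q by linarith
  next
    case False
    have "(\<Prod>j\<in>A - {i}. x j - r) \<le> 2 * ?Q * (1 / x i)" if i: "i \<in> A" for i
    proof -
      let ?P = "\<Prod>j\<in>A - {i}. x j - r"
      have "?P \<ge> 0" using gt by (intro prod_nonneg) (auto simp: less_imp_le)
      then have "x i / 2 * ?P \<le> (x i - r) * ?P"
        using half[OF i] by (intro mult_right_mono) auto
      also have "\<dots> = ?Q" using fin i by (simp add: prod.remove)
      finally show ?thesis using pos[OF i] by (simp add: field_simps)
    qed
    then have "(\<Sum>i\<in>A. \<Prod>j\<in>A - {i}. x j - r) \<le> 2 * ?Q * (\<Sum>i\<in>A. 1 / x i)"
      unfolding sum_distrib_left by (rule sum_mono)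
    then have "r * (\<Sum>i\<in>A. \<Prod>j\<in>A - {i}. x j - r) \<le> r * (2 * ?Q * (\<Sum>i\<in>A. 1 / x i))"
      using False by (intro mult_left_mono) auto
    also have "\<dots> = ?Q * (2 * r * (\<Sum>i\<in>A. 1 / x i))" by simp
    also have "\<dots> < ?Q * 1" using Q r by (intro mult_strict_left_mono)
    finally show ?thesis by simp
  qed
qed

text \<open>Since \<open>x i - t \<le> x i\<close>, each product omitting \<open>i\<close> is at
  least \<open>?Q / x i\<close>; summing and multiplying by \<open>t\<close> recovers exactly
  \<open>?Q\<close>.\<close>

lemma pderiv_nonpos_at:
  assumes t: "t * (\<Sum>i\<in>A. 1 / x i) = 1"
  shows "(\<Prod>i\<in>A. x i - t) - t * (\<Sum>i\<in>A. \<Prod>j\<in>A - {i}. x j - t) \<le> 0"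
proof -
  let ?Q = "\<Prod>i\<in>A. x i - t"
  have "(\<Sum>i\<in>A. 1 / x i) \<ge> 0"
    using pos by (intro sum_nonneg) (auto simp: less_imp_le)
  then have tpos: "t > 0" using t by (smt (verit) mult_nonpos_nonneg)
  have ge: "x i - t \<ge> 0" if i: "i \<in> A" for i
  proof -
    have "t * (1 / x i) \<le> t * (\<Sum>i\<in>A. 1 / x i)"
      using tpos by (intro mult_left_mono inverse_le_sum_inverse i) auto
    then show ?thesis using t pos[OF i] by (simp add: field_simps)
  qed
  \<comment> \<open>The bound divides by \<open>x i\<close> and never by \<open>x i - t\<close>,
    which is 0 when \<open>A\<close> is a singleton.\<close>
  have "?Q * (1 / x i) \<le> (\<Prod>j\<in>A - {i}. x j - t)" if i: "i \<in> A" for i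
  proof -
    let ?P = "\<Prod>j\<in>A - {i}. x j - t"
    have "?P \<ge> 0" using ge by (intro prod_nonneg) auto
    then have "(x i - t) * ?P \<le> x i * ?P" using tpos by (intro mult_right_mono) auto
    moreover have "(x i - t) * ?P = ?Q" using fin i by (simp add: prod.remove)
    ultimately show ?thesis using pos[OF i] by (simp add: field_simps)
  qed
  then have "?Q * (\<Sum>i\<in>A. 1 / x i) \<le> (\<Sum>i\<in>A. \<Prod>j\<in>A - {i}. x j - t)"
    unfolding sum_distrib_left by (rule sum_mono)
  then have "t * (?Q * (\<Sum>i\<in>A. 1 / x i)) \<le> t * (\<Sum>i\<in>A. \<Prod>j\<in>A - {i}. x j - t)"
    using tpos by (intro mult_left_mono) auto
  moreover have "t * (?Q * (\<Sum>i\<in>A. 1 / x i)) = ?Q"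
    using t by (simp add: mult.left_commute)
  ultimately show ?thesis by simp
qed

end

text \<open>A nonzero polynomial has finitely many roots, so \<open>Min\<close> is attained once
  there is one.\<close>

lemma smallest_root_exists:
  assumes "q \<noteq> 0" and "poly q r = 0"
  obtains \<mu> where "is_smallest_root q \<mu>"
proof
  show "is_smallest_root q (Min {r. poly q r = 0})"
    using Min_in[of "{r. poly q r = 0}"] poly_roots_finite[OF assms(1)] assms(2)
    unfolding is_smallest_root_def by auto
qed

theorem lemmaC:
  fixes n :: nat and x :: "nat \<Rightarrow> real" and p :: "real poly"
  assumes "n \<ge> 2"
    and "\<And>i. i \<in> {1..n-1} \<Longrightarrow> x i > 0"
    and "p = [:0, 1:] * (\<Prod>i=1..n-1. [:- x i, 1:])"
  shows "is_smallest_root p 0 \<and>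
    (\<exists>\<mu>. is_smallest_root (pderiv p) \<mu> \<and>
      1 / 2 * harmonic_mean (n - 1) x \<le> (real n - 1) * \<mu> \<and>
      (real n - 1) * \<mu> \<le> harmonic_mean (n - 1) x)"
proof
  show "is_smallest_root p 0"
    using assms(2) unfolding is_smallest_root_def assms(3)
    by (auto simp: poly_prod less_imp_le)
next
  define A where "A = {1..n-1}"
  define S where "S = (\<Sum>i\<in>A. 1 / x i)"
  define P where "P = [:0, 1:] * (\<Prod>i\<in>A. [:x i, - 1:])"
  have fin: "finite A" and pos: "\<And>i. i \<in> A \<Longrightarrow> x i > 0"
    using assms(2) by (auto simp: A_def)
  have "A \<noteq> {}" using assms(1) by (auto simp: A_def)
  then have S: "S > 0" unfolding S_def using fin pos by (intro sum_pos) auto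
  have F: "poly (pderiv P) t = (\<Prod>i\<in>A. x i - t) - t * (\<Sum>i\<in>A. \<Prod>j\<in>A - {i}. x j - t)" for t
    unfolding P_def by (rule poly_pderiv_prod_linear)
  \<comment> \<open>Reversing all factors multiplies the polynomial by a nonzero constant, so
    \<open>p\<close> and \<open>P\<close> have derivatives with the same roots.\<close>
  have "(\<Prod>i\<in>A. [:- x i, 1:]) = (\<Prod>i\<in>A. - [:x i, - 1:])" by simp
  also have "\<dots> = (- 1) ^ card A * (\<Prod>i\<in>A. [:x i, - 1:])" by (rule prod_uminus)
  also have "\<dots> = smult ((- 1) ^ card A) (\<Prod>i\<in>A. [:x i, - 1:])"
    by (cases "even (card A)") auto
  finally have "p = smult ((- 1) ^ card A) P"
    unfolding assms(3) P_def A_def by simp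
  then have root_iff: "poly (pderiv p) t = 0 \<longleftrightarrow> poly (pderiv P) t = 0" for t
    by (simp add: pderiv_smult)
  have below: "poly (pderiv P) t > 0" if "2 * t * S < 1" for t
    unfolding F using pderiv_pos_below[OF fin pos] that by (simp add: S_def)
  have at: "poly (pderiv P) (1 / S) \<le> 0"
    unfolding F by (rule pderiv_nonpos_at[OF fin pos]) (use S in \<open>simp_all flip: S_def\<close>)
  have zero: "poly (pderiv P) 0 > 0" by (rule below) simp
  have "\<exists>t\<ge>0. t \<le> 1 / S \<and> poly (pderiv P) t = 0"
    by (rule IVT2[of "poly (pderiv P)"]) (use at zero S in \<open>auto simp: less_imp_le\<close>)
  then obtain t where t: "t \<le> 1 / S" "poly (pderiv p) t = 0"
    using root_iff by blast
  \<comment> \<open>The strict sign at 0 excludes the zero polynomial, which has no smallest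
    root.\<close>
  have "pderiv p \<noteq> 0" using zero root_iff[of 0] by auto
  then obtain \<mu> where \<mu>: "is_smallest_root (pderiv p) \<mu>"
    using smallest_root_exists t(2) by blast
  have "poly (pderiv P) \<mu> = 0" using \<mu> root_iff by (auto simp: is_smallest_root_def)
  then have "2 * \<mu> * S \<ge> 1" using below[of \<mu>] by (cases "2 * \<mu> * S < 1") auto
  then have lower: "1 / 2 * (1 / S) \<le> \<mu>" using S by (simp add: field_simps)
  have upper: "\<mu> \<le> 1 / S" using \<mu> t by (force simp: is_smallest_root_def)
  have m: "real (n - 1) = real n - 1" "real n - 1 > 0" using assms(1) by auto
  \<comment> \<open>The factor \<open>n - 1\<close> cancels the averaging in the harmonic mean, so
    scaling the bounds on \<open>\<mu>\<close> by it gives the claim.\<close>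
  have H: "harmonic_mean (n - 1) x = (real n - 1) * (1 / S)"
    unfolding harmonic_mean_def m S_def A_def by simp
  have "(real n - 1) * (1 / 2 * (1 / S)) \<le> (real n - 1) * \<mu>"
    "(real n - 1) * \<mu> \<le> (real n - 1) * (1 / S)"
    using m lower upper by (intro mult_left_mono; simp)+
  then show "\<exists>\<mu>. is_smallest_root (pderiv p) \<mu> \<and>
      1 / 2 * harmonic_mean (n - 1) x \<le> (real n - 1) * \<mu> \<and>
      (real n - 1) * \<mu> \<le> harmonic_mean (n - 1) x"
    using \<mu> unfolding H by (intro exI[of _ \<mu>]) simp
qed

end
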